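(* Let $$T_q(l)=q^{-l}+(-1)^l q^{-l}-q^l+(-1)^l q^l+2(-1)^l.$$ Then $$\partial_q G_{n,q}^{(\alpha)}(x)=\frac{1}{2(1-q)}\sum_{l=0}^{n}\binom{n}{l}_{q}\,T_q(l)\,x^{l-1}\,G_{n-l,q}^{(\alpha)}.$$
   Context: Let $q\in\mathbb{C}$ with $|q|<1$, let $\alpha$ denote the order (a parameter on which no further restriction is stated), and let $n$ be a nonnegative integer index. Put $[x]_q=\frac{1-q^x}{1-q}$, $[n]_q!=[n]_q[n-1]_q\cdots[1]_q$ (with $[0]_q!=1$), and $\binom{k}{n}_q=\frac{[k]_q[k-1]_q\cdots[k-n+1]_q}{[n]_q!}$. The $q$-exponential function is $e_q(z)=\sum_{l=0}^\infty \frac{z^l}{[l]_q!}$. The $q$-Genocchi polynomials of higher order (of order $\alpha$), $G_{n,q}^{(\alpha)}(x)$, are defined by the generating function $$\sum_{n=0}^{\infty}\frac{z^n}{[n]_q!}G_{n,q}^{(\alpha)}(x)=\left(\frac{[2]_q z}{e_q(z)+1}\right)^{\alpha}e_q(zx),$$ and the $q$-Genocchi numbers of higher order, $G_{n,q}^{(\alpha)}$, are the coefficients in $$\sum_{n=0}^{\infty}\frac{z^n}{[n]_q!}G_{n,q}^{(\alpha)}=\left(\frac{[2]_q z}{e_q(z)+1}\right)^{\alpha}.$$ Rubin's $q$-differential operator $\partial_q$, acting on functions of $x$, is defined by $$\partial_q(f)(x)=\frac{f(q^{-1}x)+f(-q^{-1}x)-f(qx)+f(-qx)-2f(-x)}{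2(1-q)x}.$$
   Formalization: The last term of T_q(l) is taken as −2(−1)^l instead of +2(−1)^l, since the printed formula fails for α=0, n=0 (left side 0, right side 4/(2(1−q)x)); q≠0 and x≠0 are assumed so that the expressions are defined. *)

theory Defs
  imports "HOL-Complex_Analysis.Complex_Analysis"
begin

definition q_num :: "complex \<Rightarrow> nat \<Rightarrow> complex" where
  "q_num q k = (1 - q ^ k) / (1 - q)"

definition q_fact :: "complex \<Rightarrow> nat \<Rightarrow> complex" where
  "q_fact q n = (\<Prod>i=1..n. q_num q i)"

(* For n > k the product contains the factor [0]_q = 0, so truncated subtraction is harmless. *)
definition q_binomial :: "complex \<Rightarrow> nat \<Rightarrow> nat \<Rightarrow> complex" where
  "q_binomial q k n = (\<Prod>i<n. q_num q (k - i)) / q_fact q n"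

definition q_exp :: "complex \<Rightarrow> complex \<Rightarrow> complex" where
  "q_exp q z = (\<Sum>l. z ^ l / q_fact q l)"

(*
  The generating functions are read as identities of convergent power series for all z in some
  punctured neighbourhood of 0 (the series e_q has radius of convergence 1 / |1 - q|).  The point
  z = 0 is left out because 0 powr a = 0 for every a, also for a = 0; the coefficients are
  determined by the remaining z.  The order is an arbitrary complex number and the power is the
  principal one: for a natural number it is the ordinary power, and for other orders the right-hand
  side has no power series expansion about 0.  The neighbourhood may depend on x.
*)
definition q_genocchi_gf :: "complex \<Rightarrow> complex \<Rightarrow> complex \<Rightarrow> complex" where
  "q_genocchi_gf q \<alpha> z = (q_num q 2 * z / (q_exp q z + 1)) powr \<alpha>"

definition is_q_genocchi_numbers :: "complex \<Rightarrow> complex \<Rightarrow> (nat \<Rightarrow> complex) \<Rightarrow> bool" where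
  "is_q_genocchi_numbers q \<alpha> g \<longleftrightarrow>
     (\<forall>\<^sub>F z in at 0. (\<lambda>n. z ^ n / q_fact q n * g n) sums q_genocchi_gf q \<alpha> z)"

definition is_q_genocchi_polynomials ::
    "complex \<Rightarrow> complex \<Rightarrow> (nat \<Rightarrow> complex \<Rightarrow> complex) \<Rightarrow> bool" where
  "is_q_genocchi_polynomials q \<alpha> G \<longleftrightarrow>
     (\<forall>x. \<forall>\<^sub>F z in at 0.
        (\<lambda>n. z ^ n / q_fact q n * G n x) sums (q_genocchi_gf q \<alpha> z * q_exp q (z * x)))"

definition rubin_diff :: "complex \<Rightarrow> (complex \<Rightarrow> complex) \<Rightarrow> complex \<Rightarrow> complex" where
  "rubin_diff q f x =
     (f (inverse q * x) + f (- (inverse q * x)) - f (q * x) + f (- (q * x)) - 2 * f (- x))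
     / (2 * (1 - q) * x)"

(*
  The last summand is - 2 (-1)^l, as forced by the term - 2 f(-x) of Rubin's operator.  The
  published formula for T_q(l) has + 2 (-1)^l there, a misprint: with that sign the theorem fails
  already for order 0 and n = 0, where G_0(x) = 1 has Rubin derivative 0 while the sum over l is 4 / x.
*)
definition rubin_T :: "complex \<Rightarrow> nat \<Rightarrow> complex" where
  "rubin_T q l = q powi (- int l) + (- 1) ^ l * q powi (- int l)
     - q ^ l + (- 1) ^ l * q ^ l - 2 * (- 1) ^ l"

end

theory Submission
  imports Defs
begin

text \<open>
  Both generating functions carry the same factor
  \<open>([2]\<^sub>q z / (e\<^sub>q(z) + 1))\<^sup>\<alpha>\<close>, so near the origin the power series of the polynomials is the
  product of the power series of the numbers with that of \<open>e\<^sub>q(zx)\<close>.  All three series have a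
  positive radius of convergence, hence their Cauchy product may be compared coefficientwise, which
  gives the addition formula
  \<open>G\<^sub>n(x) = (\<Sum>l\<le>n. (n choose l)\<^sub>q x\<^sup>l g\<^bsub>n-l\<^esub>)\<close> (\<open>q_genocchi_polynomials_expand\<close>).  In particular
  \<open>G\<^sub>n\<close> is a polynomial, and Rubin's operator is linear and maps \<open>x\<^sup>l\<close> to
  \<open>T\<^sub>q(l) x\<^bsup>l-1\<^esup> / (2 (1 - q))\<close>, so applying it termwise proves the theorem.
\<close>

lemma one_minus_power_nonzero:
  fixes q :: complex
  assumes "norm q < 1" "k > 0"
  shows "1 - q ^ k \<noteq> 0"
proof
  assume "1 - q ^ k = 0"
  then have "norm q ^ k = 1" by (metis eq_iff_diff_eq_0 norm_one norm_power)
  moreover have "norm q ^ k < 1"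
    using assms by (simp add: power_less_one_iff)
  ultimately show False by simp
qed

lemma q_num_nonzero:
  assumes "norm q < 1" "k > 0"
  shows "q_num q k \<noteq> 0"
  using one_minus_power_nonzero[of q k] one_minus_power_nonzero[of q 1] assms
  by (simp add: q_num_def)

lemma q_fact_nonzero:
  assumes "norm q < 1"
  shows "q_fact q n \<noteq> 0"
  using q_num_nonzero[OF assms] by (simp add: q_fact_def)

lemma q_fact_Suc: "q_fact q (Suc n) = q_fact q n * q_num q (Suc n)"
  by (simp add: q_fact_def)

lemma q_fact_eq_prod_mult:
  assumes "l \<le> n"
  shows "q_fact q n = (\<Prod>i<l. q_num q (n - i)) * q_fact q (n - l)"
  using assms
proof (induction l)
  case (Suc l)
  then have "n - l = Suc (n - Suc l)" by simp
  then have "q_fact q (n - l) = q_num q (n - l) * q_fact q (n - Suc l)"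
    using q_fact_Suc[of q "n - Suc l"] by simp
  with Suc show ?case by (simp add: mult_ac)
qed simp

lemma q_binomial_eq_q_fact:
  assumes "norm q < 1" "l \<le> n"
  shows "q_binomial q n l = q_fact q n / (q_fact q l * q_fact q (n - l))"
  using q_fact_eq_prod_mult[OF assms(2), of q] q_fact_nonzero[OF assms(1)]
  by (simp add: q_binomial_def field_simps)

text \<open>
  The \<open>q\<close>-numbers stay away from zero, because \<open>\<bar>1 - q\<^sup>k\<bar> \<ge> 1 - \<bar>q\<bar>\<close> for positive \<open>k\<close>; so the
  coefficients of the \<open>q\<close>-exponential grow at most geometrically.
\<close>
lemma norm_inverse_q_fact_le:
  assumes "norm q < 1"
  shows "norm (inverse (q_fact q n)) \<le> (norm (1 - q) / (1 - norm q)) ^ n"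
proof (induction n)
  case 0
  show ?case by (simp add: q_fact_def)
next
  case (Suc n)
  have "norm (q ^ Suc n) \<le> norm q"
    using assms power_decreasing[of 1 "Suc n" "norm q"] by (simp add: norm_power norm_mult)
  moreover have "norm (1::complex) - norm (q ^ Suc n) \<le> norm (1 - q ^ Suc n)"
    by (rule norm_triangle_ineq2)
  ultimately have le: "1 - norm q \<le> norm (1 - q ^ Suc n)"
    by simp
  have "norm (inverse (q_num q (Suc n))) = norm (1 - q) / norm (1 - q ^ Suc n)"
    by (simp add: q_num_def norm_divide norm_inverse)
  also have "\<dots> \<le> norm (1 - q) / (1 - norm q)"
    using le assms by (intro divide_left_mono mult_pos_pos) auto
  finally have "norm (inverse (q_fact q n)) * norm (inverse (q_num q (Suc n)))
      \<le> (norm (1 - q) / (1 - norm q)) ^ n * (norm (1 - q) / (1 - norm q))"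
    using assms by (intro mult_mono Suc.IH) auto
  then show ?case
    by (simp only: q_fact_Suc inverse_mult_distrib norm_mult power_Suc2)
qed

lemma fps_conv_radius_pos_if_summable:
  fixes F :: "complex fps"
  assumes "summable (\<lambda>n. fps_nth F n * z ^ n)" "z \<noteq> 0"
  shows "fps_conv_radius F > 0"
proof -
  have "ereal (norm z) \<le> fps_conv_radius F"
    unfolding fps_conv_radius_def by (rule conv_radius_geI[OF assms(1)])
  with assms(2) show ?thesis
    by (metis ereal_less(2) less_le_trans zero_less_norm_iff)
qed

definition q_exp_fps :: "complex \<Rightarrow> complex \<Rightarrow> complex fps" where
  "q_exp_fps q x = Abs_fps (\<lambda>n. x ^ n / q_fact q n)"

lemma eval_q_exp_fps: "eval_fps (q_exp_fps q x) z = q_exp q (z * x)"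
  by (simp add: eval_fps_def q_exp_fps_def q_exp_def power_mult_distrib mult.commute)

lemma fps_conv_radius_q_exp_fps_pos:
  assumes "norm q < 1"
  shows "fps_conv_radius (q_exp_fps q x) > 0"
proof -
  define K where "K = norm (1 - q) / (1 - norm q)"
  have "q \<noteq> 1" using assms by auto
  with assms have K: "K > 0" by (simp add: K_def)
  (* The summand 1 keeps M invertible for x = 0; the series is tested at the point 1 / (2 * M). *)
  define M where "M = K * (norm x + 1)"
  have M: "M > 0" unfolding M_def using K by (intro mult_pos_pos add_nonneg_pos) auto
  define z :: complex where "z = of_real (1 / (2 * M))"
  have "norm (fps_nth (q_exp_fps q x) n * z ^ n) \<le> (1 / 2) ^ n" for n
  proof -
    have "norm (fps_nth (q_exp_fps q x) n) = norm x ^ n * norm (inverse (q_fact q n))"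
      by (simp add: q_exp_fps_def norm_divide norm_inverse norm_power divide_inverse norm_mult)
    also have "\<dots> \<le> (norm x + 1) ^ n * K ^ n"
      using norm_inverse_q_fact_le[OF assms, of n] K
      by (intro mult_mono power_mono) (auto simp: K_def)
    also have "\<dots> = M ^ n" by (simp add: M_def power_mult_distrib mult.commute)
    finally have "norm (fps_nth (q_exp_fps q x) n * z ^ n) \<le> M ^ n * norm z ^ n"
      by (simp add: norm_mult norm_power mult_right_mono)
    also have "\<dots> = (1 / 2) ^ n"
      using M by (simp add: z_def power_mult_distrib[symmetric] norm_divide)
    finally show ?thesis .
  qed
  then have "summable (\<lambda>n. fps_nth (q_exp_fps q x) n * z ^ n)"
    by (intro summable_comparison_test'[OF summable_geometric[of "1 / 2 :: real"]]) auto
  then show ?thesis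
    by (rule fps_conv_radius_pos_if_summable) (use M in \<open>simp add: z_def\<close>)
qed

lemma eventually_sums_fps:
  fixes F :: "complex fps"
  assumes "\<forall>\<^sub>F z in at 0. (\<lambda>n. fps_nth F n * z ^ n) sums f z"
  shows "fps_conv_radius F > 0" and "\<forall>\<^sub>F z in at 0. eval_fps F z = f z"
proof -
  have "\<forall>\<^sub>F z in at (0::complex). (\<lambda>n. fps_nth F n * z ^ n) sums f z \<and> z \<noteq> 0"
    using assms by (auto intro: eventually_conj simp: eventually_at_filter)
  then obtain z where "(\<lambda>n. fps_nth F n * z ^ n) sums f z" "z \<noteq> 0"
    using eventually_happens[of _ "at (0::complex)"] by auto
  then show "fps_conv_radius F > 0"
    by (intro fps_conv_radius_pos_if_summable[of F z]) (auto simp: sums_iff)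
  show "\<forall>\<^sub>F z in at 0. eval_fps F z = f z"
    using assms by eventually_elim (simp add: eval_fps_def sums_iff)
qed

text \<open>
  The value at the origin is recovered by continuity, so equality of two convergent power series on
  a punctured neighbourhood already forces equality of the coefficients.
\<close>
lemma fps_eqI_eventually_at:
  fixes F H :: "complex fps"
  assumes "fps_conv_radius F > 0" "fps_conv_radius H > 0"
    and "\<forall>\<^sub>F z in at 0. eval_fps F z = eval_fps H z"
  shows "F = H"
proof (rule eval_fps_eqD[OF assms(1,2)])
  have "(eval_fps F \<longlongrightarrow> eval_fps F 0) (at 0)"
    using assms(1) continuous_eval_fps[of 0 F UNIV] by (simp add: isCont_def zero_ereal_def)
  moreover have "(eval_fps H \<longlongrightarrow> eval_fps H 0) (at 0)"
    using assms(2) continuous_eval_fps[of 0 H UNIV] by (simp add: isCont_def zero_ereal_def)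
  ultimately have "eval_fps F 0 = eval_fps H 0"
    using assms(3) by (metis tendsto_cong tendsto_unique at_neq_bot)
  with assms(3) show "\<forall>\<^sub>F z in nhds 0. eval_fps F z = eval_fps H z"
    by (simp add: eventually_nhds_conv_at)
qed

text \<open>
  This is the coefficient comparison in \<open>\<Sum> G\<^sub>n(x) z\<^sup>n / [n]! = (\<Sum> g\<^sub>n z\<^sup>n / [n]!) e\<^sub>q(zx)\<close>.
\<close>
lemma q_genocchi_polynomials_expand:
  assumes q: "norm q < 1"
    and g: "is_q_genocchi_numbers q \<alpha> g"
    and G: "is_q_genocchi_polynomials q \<alpha> G"
  shows "G n x = (\<Sum>l=0..n. q_binomial q n l * x ^ l * g (n - l))"
proof -
  define A where "A = Abs_fps (\<lambda>n. g n / q_fact q n)"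
  define P where "P = Abs_fps (\<lambda>n. G n x / q_fact q n)"
  define E where "E = q_exp_fps q x"
  have "\<forall>\<^sub>F z in at 0. (\<lambda>n. fps_nth A n * z ^ n) sums q_genocchi_gf q \<alpha> z"
    using g by (simp add: is_q_genocchi_numbers_def A_def mult.commute)
  note A = eventually_sums_fps[OF this]
  have "\<forall>\<^sub>F z in at 0. (\<lambda>n. fps_nth P n * z ^ n) sums (q_genocchi_gf q \<alpha> z * q_exp q (z * x))"
    using G by (simp add: is_q_genocchi_polynomials_def P_def mult.commute[of "_ ^ _"])
  note P = eventually_sums_fps[OF this]
  have E: "fps_conv_radius E > 0"
    unfolding E_def by (rule fps_conv_radius_q_exp_fps_pos[OF q])
  have conv: "\<forall>\<^sub>F z in at (0::complex). ereal (norm z) < fps_conv_radius F"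
    if "fps_conv_radius F > 0" for F :: "complex fps"
    using eventually_at_in_open'[of "eball 0 (fps_conv_radius F)" 0] that
    by (auto simp: in_eball_iff zero_ereal_def elim!: eventually_mono)
  have "P = E * A"
  proof (rule fps_eqI_eventually_at)
    show "fps_conv_radius P > 0" by (rule P(1))
    show "fps_conv_radius (E * A) > 0"
      using fps_conv_radius_mult[of E A] A(1) E by (simp add: less_le_trans[rotated])
    show "\<forall>\<^sub>F z in at 0. eval_fps P z = eval_fps (E * A) z"
      using A(2) P(2) conv[OF A(1)] conv[OF E]
      by eventually_elim (simp add: eval_fps_mult E_def eval_q_exp_fps mult.commute)
  qed
  then have "G n x / q_fact q n
      = (\<Sum>l=0..n. x ^ l / q_fact q l * (g (n - l) / q_fact q (n - l)))"
    by (metis (mono_tags, lifting) P_def E_def A_def q_exp_fps_def fps_mult_nth fps_nth_Abs_fps sum.cong)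
  then have "G n x
      = (\<Sum>l=0..n. q_fact q n * (x ^ l / q_fact q l * (g (n - l) / q_fact q (n - l))))"
    unfolding sum_distrib_left[symmetric]
    using q_fact_nonzero[OF q, of n] by (simp add: field_simps)
  also have "\<dots> = (\<Sum>l=0..n. q_binomial q n l * x ^ l * g (n - l))"
    by (intro sum.cong) (simp_all add: q_binomial_eq_q_fact[OF q])
  finally show ?thesis .
qed

lemma rubin_diff_sum:
  "rubin_diff q (\<lambda>y. \<Sum>l\<in>A. c l * f l y) x = (\<Sum>l\<in>A. c l * rubin_diff q (f l) x)"
  by (simp add: rubin_diff_def sum_distrib_left sum_subtractf[symmetric] sum.distrib[symmetric]
      sum_divide_distrib algebra_simps)

lemma rubin_diff_power:
  assumes "x \<noteq> 0"
  shows "rubin_diff q (\<lambda>y. y ^ l) x = rubin_T q l * x powi (int l - 1) / (2 * (1 - q))"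
proof -
  have neg: "(- y) ^ l = (- 1) ^ l * y ^ l" for y :: complex
    by (rule power_minus)
  have "x powi (int l - 1) = x ^ l / x"
    using assms by (simp add: power_int_diff)
  moreover have "q powi (- int l) = inverse q ^ l"
    by (simp add: power_int_minus power_inverse)
  ultimately show ?thesis
    by (simp add: rubin_diff_def rubin_T_def neg[of "inverse q * x"] neg[of "q * x"] neg[of x]
        power_mult_distrib) (simp add: algebra_simps)
qed

theorem theorem2p5:
  fixes q \<alpha> x :: complex and n :: nat
    and g :: "nat \<Rightarrow> complex" and G :: "nat \<Rightarrow> complex \<Rightarrow> complex"
  assumes "norm q < 1" and "q \<noteq> 0"
    and "is_q_genocchi_numbers q \<alpha> g"
    and "is_q_genocchi_polynomials q \<alpha> G"
    and "x \<noteq> 0"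
  shows "rubin_diff q (G n) x =
    1 / (2 * (1 - q)) *
      (\<Sum>l=0..n. q_binomial q n l * rubin_T q l * x powi (int l - 1) * g (n - l))"
proof -
  have "G n = (\<lambda>y. \<Sum>l=0..n. (q_binomial q n l * g (n - l)) * y ^ l)"
    using q_genocchi_polynomials_expand[OF assms(1,3,4)] by (auto simp: mult_ac)
  then have "rubin_diff q (G n) x
      = (\<Sum>l=0..n. (q_binomial q n l * g (n - l)) * rubin_diff q (\<lambda>y. y ^ l) x)"
    by (simp only: rubin_diff_sum)
  also have "\<dots> = (\<Sum>l=0..n. 1 / (2 * (1 - q)) *
      (q_binomial q n l * rubin_T q l * x powi (int l - 1) * g (n - l)))"
    by (intro sum.cong) (simp_all add: rubin_diff_power[OF assms(5)])
  finally show ?thesis by (simp only: sum_distrib_left)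
qed

end
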